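(* Let $\alpha\in(0,2]$ and let $\rho\in\mathbb{R}$ satisfy \[ \rho\in\begin{cases}\left[\frac{-\alpha}{1-\alpha},1\right) & \text{if }\alpha\in(0,1),\\ [0,1] & \text{if }\alpha=1,\\ \left(1,\frac{\alpha}{\alpha-1}\right] & \text{if }\alpha\in(1,2].\end{cases} \] Then the function \[ H(z)=\begin{cases}1-\left[\rho(1-z)+(1-\rho)(1-z)^\alpha\right] & \text{if }\alpha\neq1,\\ z+\rho(1-z)\log(1-z) & \text{if }\alpha=1\end{cases} \] is a valid probability generating function of a count variable with support on $\mathbb{N}=\{1,2,\ldots\}$ (i.e. taking values in $\mathbb{N}$, so that $H(0)=0$).
   Context: A count variable is a random variable taking values in $\mathbb{N}_0=\{0,1,2,\ldots\}$; its probability generating function is $z\mapsto\mathbb{E}[z^X]=\sum_{n\ge0}z^n\Pr(X=n)$, considered for $z\in[0,1]$. Convention: $0\log0=0$. *)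

theory Defs
  imports "HOL-Probability.Probability"
begin

definition count_variable :: "'a measure \<Rightarrow> ('a \<Rightarrow> nat) \<Rightarrow> bool" where
  "count_variable M X \<longleftrightarrow> prob_space M \<and> X \<in> measurable M (count_space UNIV)"

(* Meant for z in [0,1], where the integrand is bounded and hence integrable. *)
definition pgf :: "'a measure \<Rightarrow> ('a \<Rightarrow> nat) \<Rightarrow> real \<Rightarrow> real" where
  "pgf M X z = (\<integral>\<omega>. z ^ X \<omega> \<partial>M)"

(* At z = 1 the library's 0 powr a = 0 agrees with 0^a for a > 0, and the product
   0 * ln 0 is 0, as in the convention 0 log 0 = 0. *)
definition H :: "real \<Rightarrow> real \<Rightarrow> real \<Rightarrow> real" where
  "H \<alpha> \<rho> z =
     (if \<alpha> \<noteq> 1 then 1 - (\<rho> * (1 - z) + (1 - \<rho>) * (1 - z) powr \<alpha>)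
      else z + \<rho> * (1 - z) * ln (1 - z))"

(* A function on [0,1] is a valid generating function if it is the pgf of some count
   variable on some probability space. Quantifying over probability spaces on the type nat
   loses nothing, because the law of a count variable lives there. *)
definition valid_pgf_with_values_in :: "nat set \<Rightarrow> (real \<Rightarrow> real) \<Rightarrow> bool" where
  "valid_pgf_with_values_in S G \<longleftrightarrow>
     (\<exists>(M :: nat measure) X. count_variable M X \<and> (\<forall>\<omega>\<in>space M. X \<omega> \<in> S) \<and>
        (\<forall>z\<in>{0..1}. pgf M X z = G z))"

end

theory Submission
  imports Defs "HOL-Real_Asymp.Real_Asymp"
begin

text \<open>
  \<open>H\<close> has on \<open>[0, 1)\<close> a power series without constant term: the binomial series when
  \<open>\<alpha> \<noteq> 1\<close>, the series of the logarithm multiplied by \<open>1 - z\<close> when \<open>\<alpha> = 1\<close>. Two things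
  make it a generating function.

  The coefficients are nonnegative. For \<open>\<alpha> \<noteq> 1\<close> the coefficient of \<open>z\<close> is
  \<open>\<rho> + (1 - \<rho>) \<alpha>\<close>, and the closed end of the range of \<open>\<rho>\<close> is exactly the value where it
  vanishes. The later coefficients are those of \<open>(1 - z) powr \<alpha>\<close> times \<open>\<rho> - 1\<close>; because
  \<open>\<alpha> \<le> 2\<close> those that do not vanish have the sign of \<open>\<alpha> - 1\<close> (lemma \<open>binomial_coeffs_sign\<close>), which is
  also the sign of \<open>\<rho> - 1\<close>. For \<open>\<alpha> = 1\<close> the coefficients are \<open>1 - \<rho>\<close> and
  \<open>\<rho> / (n (n + 1))\<close>.

  The coefficients add up to \<open>1\<close>, because \<open>H\<close> tends to \<open>1 = H(1)\<close> at \<open>1\<close> and, for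
  nonnegative coefficients, the limit of a power series at the boundary is the sum of the
  coefficients. This is the lemma \<open>valid_pgf_from_power_series\<close>, which also builds the
  random variable.
\<close>

section \<open>Generating functions from power series\<close>

text \<open>
  A converse of Abel's theorem: for nonnegative coefficients every partial sum is a limit of
  partial sums below \<open>G\<close>, so it is bounded by the limit of \<open>G\<close>; convergence at \<open>1\<close> then
  follows by monotonicity.
\<close>

lemma nonneg_power_series_sums_at_one:
  fixes p :: "nat \<Rightarrow> real"
  assumes nonneg: "\<And>n. 0 \<le> p n"
    and series: "\<And>z. 0 \<le> z \<Longrightarrow> z < 1 \<Longrightarrow> (\<lambda>n. p n * z ^ Suc n) sums G z"
    and lim: "(G \<longlongrightarrow> l) (at_left 1)"
  shows "p sums l"
proof -
  have near: "\<forall>\<^sub>F z in at_left (1::real). 0 < z \<and> z < 1"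
    using eventually_at_left_field by force
  have partial: "sum p {..<N} \<le> l" for N
  proof (rule tendsto_le[OF _ lim])
    have "((\<lambda>z. \<Sum>n<N. p n * z ^ Suc n) \<longlongrightarrow> (\<Sum>n<N. p n * 1 ^ Suc n)) (at_left 1)"
      by (intro tendsto_intros)
    then show "((\<lambda>z. \<Sum>n<N. p n * z ^ Suc n) \<longlongrightarrow> sum p {..<N}) (at_left 1)"
      by simp
    show "\<forall>\<^sub>F z in at_left 1. (\<Sum>n<N. p n * z ^ Suc n) \<le> G z"
      using near
    proof eventually_elim
      case (elim z)
      then show ?case
        using sum_le_suminf[of "\<lambda>n. p n * z ^ Suc n" "{..<N}"] series[of z] nonneg
        by (simp add: sums_iff)
    qed
  qed simp
  have summable: "summable p"
    using partial nonneg by (intro summableI_nonneg_bounded)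
  have "suminf p \<le> l"
    using partial summable by (intro suminf_le_const)
  moreover have "l \<le> suminf p"
  proof (rule tendsto_upperbound[OF lim])
    show "\<forall>\<^sub>F z in at_left 1. G z \<le> suminf p"
      using near
    proof eventually_elim
      case (elim z)
      have "p n * z ^ Suc n \<le> p n" for n
        using elim nonneg[of n] by (intro mult_right_le_one_le power_le_one zero_le_power) auto
      then show ?case
        using suminf_le[of "\<lambda>n. p n * z ^ Suc n" p] series[of z] summable elim
        by (simp add: sums_iff)
    qed
  qed simp
  ultimately show ?thesis
    using summable by (simp add: sums_iff)
qed

text \<open>
  The variable is \<open>Suc\<close> on \<open>nat\<close> with the law \<open>p\<close>. With this shift its values are
  positive at every point of the space, not only almost surely.
\<close>

lemma valid_pgf_from_power_series:
  fixes p :: "nat \<Rightarrow> real"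
  assumes nonneg: "\<And>n. 0 \<le> p n"
    and series: "\<And>z. 0 \<le> z \<Longrightarrow> z < 1 \<Longrightarrow> (\<lambda>n. p n * z ^ Suc n) sums G z"
    and lim: "(G \<longlongrightarrow> 1) (at_left 1)" and one: "G 1 = 1"
  shows "valid_pgf_with_values_in {1..} G"
proof -
  have total: "p sums 1"
    using nonneg series lim by (rule nonneg_power_series_sums_at_one)
  have mass: "(\<integral>\<^sup>+n. ennreal (p n) \<partial>count_space UNIV) = 1"
    using total nonneg
    by (simp add: nn_integral_count_space_nat suminf_ennreal2 sums_iff)
  define M where "M = measure_pmf (embed_pmf p)"
  have "pgf M Suc z = G z" if z: "z \<in> {0..1}" for z
  proof -
    have sums_G: "(\<lambda>n. p n * z ^ Suc n) sums G z"
      using series[of z] total one z by (cases "z = 1") auto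
    have "pgf M Suc z = infsetsum (\<lambda>n. p n * z ^ Suc n) UNIV"
      unfolding pgf_def M_def using nonneg mass
      by (simp add: pmf_expectation_eq_infsetsum pmf_embed_pmf del: power_Suc)
    also have "\<dots> = (\<Sum>n. p n * z ^ Suc n)"
      using sums_G nonneg z
      by (intro infsetsum_nat') (auto simp: abs_summable_on_nat_iff' sums_iff)
    finally show ?thesis
      using sums_G by (simp add: sums_iff)
  qed
  moreover have "count_variable M Suc"
    unfolding count_variable_def M_def by (simp add: measure_pmf.prob_space_axioms)
  ultimately show ?thesis
    unfolding valid_pgf_with_values_in_def by (intro exI[of _ M] exI[of _ Suc]) auto
qed

section \<open>Coefficients of the binomial series\<close>

text \<open>
  Consecutive coefficients of \<open>(1 - z) powr a\<close> have the ratio \<open>(n - a) / (n + 1)\<close>, which is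
  nonnegative from \<open>n = 2\<close> on when \<open>a \<le> 2\<close>. So from the coefficient of \<open>z\<^sup>2\<close> on, which is
  \<open>a (a - 1) / 2\<close>, the sign does not change.
\<close>

lemma binomial_coeffs_sign:
  fixes a :: real
  assumes "0 \<le> a" "a \<le> 2"
  shows "0 \<le> (a - 1) * ((- 1) ^ Suc (Suc n) * (a gchoose Suc (Suc n)))"
proof (induction n)
  case 0
  have "(a - 1) * ((- 1) ^ Suc (Suc 0) * (a gchoose Suc (Suc 0))) = a * (a - 1)\<^sup>2 / 2"
    by (simp add: gbinomial_Suc_rec power2_eq_square)
  then show ?case
    using assms by (simp only:) simp
next
  case (Suc n)
  have "(a - 1) * ((- 1) ^ Suc (Suc (Suc n)) * (a gchoose Suc (Suc (Suc n))))
    = (a - 1) * ((- 1) ^ Suc (Suc n) * (a gchoose Suc (Suc n)))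
      * ((real (Suc (Suc n)) - a) / real (Suc (Suc (Suc n))))"
    by (simp add: gbinomial_Suc_rec[of a "Suc (Suc n)"] divide_simps) (simp add: algebra_simps)
  then show ?case
    using mult_nonneg_nonneg[OF Suc.IH, of "(real (Suc (Suc n)) - a) / real (Suc (Suc (Suc n)))"] assms
    by (simp only:) simp
qed

lemma one_minus_powr_series:
  fixes a z :: real
  assumes "0 \<le> z" "z < 1"
  shows "(\<lambda>n. ((- 1) ^ Suc n * (a gchoose Suc n)) * z ^ Suc n) sums ((1 - z) powr a - 1)"
proof -
  have "(\<lambda>n. ((- 1) ^ n * (a gchoose n)) * z ^ n) sums (1 - z) powr a"
    using gen_binomial_real[of "- z" a] assms by (simp add: power_minus[of z] mult_ac)
  then show ?thesis
    by (subst sums_Suc_iff) simp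
qed

text \<open>
  The two inequalities cover \<open>\<alpha> < 1\<close> and \<open>\<alpha> > 1\<close> together: the first is the coefficient of
  \<open>z\<close>, the second says that \<open>\<rho>\<close> and \<open>\<alpha>\<close> lie on the same side of \<open>1\<close>, which handles
  all later coefficients.
\<close>

lemma valid_pgf_H_powr:
  assumes "0 < \<alpha>" "\<alpha> \<le> 2" "\<alpha> \<noteq> 1"
    and linear: "0 \<le> \<rho> + (1 - \<rho>) * \<alpha>" and sign: "0 \<le> (\<rho> - 1) * (\<alpha> - 1)"
  shows "valid_pgf_with_values_in {1..} (H \<alpha> \<rho>)"
proof (rule valid_pgf_from_power_series)
  define c where "c n = (- 1) ^ n * (\<alpha> gchoose n)" for n
  define p where "p n = (if n = 0 then \<rho> else 0) + (\<rho> - 1) * c (Suc n)" for n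
  show "0 \<le> p n" for n
  proof (cases n)
    case 0
    then show ?thesis
      using linear by (simp add: p_def c_def algebra_simps)
  next
    case (Suc m)
    have "0 \<le> (\<alpha> - 1) * c (Suc n)"
      using binomial_coeffs_sign[of \<alpha> m] assms Suc by (simp add: c_def)
    then have "0 \<le> (\<rho> - 1) * c (Suc n)"
      using sign \<open>\<alpha> \<noteq> 1\<close> by (auto simp: zero_le_mult_iff)
    then show ?thesis
      using Suc by (simp add: p_def)
  qed
  show "(\<lambda>n. p n * z ^ Suc n) sums H \<alpha> \<rho> z" if "0 \<le> z" "z < 1" for z
  proof -
    have "(\<lambda>n. if n = 0 then \<rho> * z ^ Suc n else 0) sums (\<rho> * z ^ Suc 0)"
      by (rule sums_single)
    moreover have "(\<lambda>n. (\<rho> - 1) * (c (Suc n) * z ^ Suc n))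
        sums ((\<rho> - 1) * ((1 - z) powr \<alpha> - 1))"
      unfolding c_def using one_minus_powr_series[OF that, of \<alpha>] by (rule sums_mult)
    ultimately have "(\<lambda>n. (if n = 0 then \<rho> * z ^ Suc n else 0) + (\<rho> - 1) * (c (Suc n) * z ^ Suc n))
        sums (\<rho> * z ^ Suc 0 + (\<rho> - 1) * ((1 - z) powr \<alpha> - 1))"
      by (rule sums_add)
    moreover have "(if n = 0 then \<rho> * z ^ Suc n else 0) + (\<rho> - 1) * (c (Suc n) * z ^ Suc n)
        = p n * z ^ Suc n" for n
      by (simp add: p_def algebra_simps)
    moreover have "\<rho> * z ^ Suc 0 + (\<rho> - 1) * ((1 - z) powr \<alpha> - 1) = H \<alpha> \<rho> z"
      using \<open>\<alpha> \<noteq> 1\<close> by (simp add: H_def algebra_simps)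
    ultimately show ?thesis
      by simp
  qed
  have "((\<lambda>z::real. (1 - z) powr \<alpha>) \<longlongrightarrow> 0) (at_left 1)"
    using \<open>0 < \<alpha>\<close> by real_asymp
  then have "((\<lambda>z. 1 - (\<rho> * (1 - z) + (1 - \<rho>) * (1 - z) powr \<alpha>))
      \<longlongrightarrow> 1 - (\<rho> * (1 - 1) + (1 - \<rho>) * 0)) (at_left 1)"
    by (intro tendsto_intros)
  then show "(H \<alpha> \<rho> \<longlongrightarrow> 1) (at_left 1)"
    using \<open>\<alpha> \<noteq> 1\<close> by (simp add: H_def[abs_def])
  show "H \<alpha> \<rho> 1 = 1"
    using \<open>\<alpha> \<noteq> 1\<close> by (simp add: H_def)
qed

section \<open>The logarithmic case\<close>

text \<open>
  The coefficients arise by telescoping, \<open>1 / n - 1 / (n + 1) = 1 / (n (n + 1))\<close>. At \<open>n = 0\<close>,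
  where \<open>1 / 0 = 0\<close>, the difference is \<open>-1\<close> and supplies the term \<open>- z\<close>.
\<close>

lemma one_minus_mult_ln_series:
  fixes z :: real
  assumes "0 \<le> z" "z < 1"
  shows "(\<lambda>n. (1 / real n - 1 / real (Suc n)) * z ^ Suc n) sums ((1 - z) * ln (1 - z))"
proof -
  have ln: "(\<lambda>n. - (1 / real n) * z ^ n) sums ln (1 - z)"
    using ln_series'[of "- z"] assms by (simp add: power_minus[of z] field_simps)
  have "(\<lambda>n. - (1 / real (Suc n)) * z ^ Suc n) sums ln (1 - z)"
    using ln by (subst sums_Suc_iff) simp
  from sums_diff[OF this sums_mult[OF ln, of z]] show ?thesis
    by (simp add: algebra_simps)
qed

lemma valid_pgf_H_log:
  assumes "0 \<le> \<rho>" "\<rho> \<le> 1"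
  shows "valid_pgf_with_values_in {1..} (H 1 \<rho>)"
proof (rule valid_pgf_from_power_series)
  define p where "p n = (if n = 0 then 1 else 0) + \<rho> * (1 / real n - 1 / real (Suc n))" for n
  show "0 \<le> p n" for n
    using assms by (auto simp: p_def frac_le intro!: mult_nonneg_nonneg)
  show "(\<lambda>n. p n * z ^ Suc n) sums H 1 \<rho> z" if "0 \<le> z" "z < 1" for z
  proof -
    have "(\<lambda>n. if n = 0 then z ^ Suc n else 0) sums (z ^ Suc 0)"
      by (rule sums_single)
    from sums_add[OF this sums_mult[OF one_minus_mult_ln_series[OF that], of \<rho>]]
    have "(\<lambda>n. (if n = 0 then z ^ Suc n else 0)
        + \<rho> * ((1 / real n - 1 / real (Suc n)) * z ^ Suc n)) sums H 1 \<rho> z"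
      by (simp add: H_def mult.assoc)
    moreover have "(if n = 0 then z ^ Suc n else 0)
        + \<rho> * ((1 / real n - 1 / real (Suc n)) * z ^ Suc n) = p n * z ^ Suc n" for n
      by (simp add: p_def algebra_simps)
    ultimately show ?thesis
      by simp
  qed
  have "((\<lambda>z::real. (1 - z) * ln (1 - z)) \<longlongrightarrow> 0) (at_left 1)"
    by real_asymp
  then have "((\<lambda>z. z + \<rho> * ((1 - z) * ln (1 - z))) \<longlongrightarrow> 1 + \<rho> * 0) (at_left 1)"
    by (intro tendsto_intros)
  then show "(H 1 \<rho> \<longlongrightarrow> 1) (at_left 1)"
    by (simp add: H_def[abs_def] mult.assoc)
  show "H 1 \<rho> 1 = 1"
    by (simp add: H_def)
qed

section \<open>The range of the parameters\<close>

theorem proposition4p1: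
  fixes \<alpha> \<rho> :: real
  assumes "\<alpha> \<in> {0<..2}"
    and "\<rho> \<in> (if \<alpha> < 1 then {- \<alpha> / (1 - \<alpha>)..<1}
              else if \<alpha> = 1 then {0..1}
              else {1<..\<alpha> / (\<alpha> - 1)})"
  shows "valid_pgf_with_values_in {1..} (H \<alpha> \<rho>) \<and> H \<alpha> \<rho> 0 = 0"
proof
  show "H \<alpha> \<rho> 0 = 0"
    by (simp add: H_def)
  consider "\<alpha> < 1" | "\<alpha> = 1" | "1 < \<alpha>"
    by linarith
  then show "valid_pgf_with_values_in {1..} (H \<alpha> \<rho>)"
  proof cases
    case 1
    then have "- \<alpha> \<le> \<rho> * (1 - \<alpha>)" "\<rho> < 1"
      using assms(2) pos_divide_le_eq[of "1 - \<alpha>" "- \<alpha>" \<rho>] by auto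
    then show ?thesis
      using 1 assms(1) by (intro valid_pgf_H_powr mult_nonpos_nonpos) (auto simp: algebra_simps)
  next
    case 2
    then show ?thesis
      using assms(2) valid_pgf_H_log[of \<rho>] by simp
  next
    case 3
    then have "\<rho> * (\<alpha> - 1) \<le> \<alpha>" "1 < \<rho>"
      using assms(2) by (auto simp: pos_le_divide_eq)
    then show ?thesis
      using 3 assms(1) by (intro valid_pgf_H_powr mult_nonneg_nonneg) (auto simp: algebra_simps)
  qed
qed

end
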